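(* Let $(Y,Y^\diamond)$ be a norming dual pair such that $(Y,\sigma(Y,Y^\diamond))$ is sequentially complete. Let $\{S(t)\}_{t\ge0}$ be a twin semigroup on $(Y,Y^\diamond)$, let $q\in Y$, and let $f:[0,T]\to\mathbb R$ be bounded and measurable. Then for each $t\in[0,T]$ the linear functional $$y^\diamond\mapsto\int_0^t y^\diamond S(t-\tau)q\,f(\tau)\,d\tau$$ on $Y^\diamond$ is represented by an element of $Y$: there is $u\in Y$ with $\langle y^\diamond,u\rangle=\int_0^t y^\diamond S(t-\tau)q\,f(\tau)\,d\tau$ for all $y^\diamond\in Y^\diamond$.
   Context: Banach spaces $Y,Y^\diamond$ (real) form a norming dual pair if there is a bilinear map $\langle\cdot,\cdot\rangle:Y^\diamond\times Y\to\mathbb R$ with $|\langle y^\diamond,y\rangle|\le M\|y^\diamond\|\|y\|$ for some $M\ge1$, $\|y\|=\sup\{|\langle y^\diamond,y\rangle|:\|y^\diamond\|\le1\}$ and $\|y^\diamond\|=\sup\{|\langle y^\diamond,y\rangle|:\|y\|\le1\}$. $\sigma(Y,Y^\diamond)$ is the weak topology on $Y$ induced by $Y^\diamond$. A twin operator $L$ is a bounded bilinear map $Y^\diamond\times Y\to\mathbb R$, $(y^\diamond,y)\mapsto y^\diamond Ly$, such that for each $y$ there is $Ly\in Y$ with $\langle y^\diamond,Ly\rangle=y^\diamond Ly$ for all $y^\diamond$, and for each $y^\diamond$ there is $y^\diamond L\in Y^\diamond$ with $\langle y^\diamond L,y\rangle=y^\diamond Ly$ for all $y$. Composition: $y^\diamond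 L_1L_2y:=\langle y^\diamond L_1,L_2y\rangle$. A twin semigroup is a family $\{S(t)\}_{t\ge0}$ of twin operators with: (i) $S(0)=I$, $S(t+s)=S(t)S(s)$; (ii) $|y^\diamond S(t)y|\le Me^{\omega t}\|y\|\|y^\diamond\|$ for some $M\ge1,\omega\in\mathbb R$; (iii) $t\mapsto y^\diamond S(t)y$ is measurable for all $y,y^\diamond$; (iv) for $\operatorname{Re}\lambda>\omega$ there is a twin operator $\overline S(\lambda)$ (on the complexification if $\lambda$ is non-real) with $y^\diamond\overline S(\lambda)y=\int_0^\infty e^{-\lambda t}y^\diamond S(t)y\,dt$. *)

theory Defs
  imports "HOL-Analysis.Analysis"
begin

text \<open>A pair \<open>(Y, Y\<^sup>\<diamond>)\<close> is rendered by two types of class \<open>banach\<close>, \<open>'y\<close> for \<open>Y\<close> and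
  \<open>'d\<close> for \<open>Y\<^sup>\<diamond>\<close>, and a pairing \<open>B :: 'd \<Rightarrow> 'y \<Rightarrow> real\<close>; the dual variable comes first.\<close>

definition norming_dual_pair :: "('d::banach \<Rightarrow> 'y::banach \<Rightarrow> real) \<Rightarrow> bool" where
  "norming_dual_pair B \<longleftrightarrow>
     bounded_bilinear B \<and>
     (\<forall>y. norm y = (SUP d\<in>{d. norm d \<le> 1}. \<bar>B d y\<bar>)) \<and>
     (\<forall>d. norm d = (SUP y\<in>{y. norm y \<le> 1}. \<bar>B d y\<bar>))"

definition weak_top :: "('d \<Rightarrow> 'y \<Rightarrow> real) \<Rightarrow> 'y topology" where
  "weak_top B = topology_generated_by {{y. B d y \<in> U} | d U. open U}"

text \<open>Cauchy sequences are those of the translation invariant uniformity of the topology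
  (not of a metric).\<close>

definition top_Cauchy :: "'y::real_vector topology \<Rightarrow> (nat \<Rightarrow> 'y) \<Rightarrow> bool" where
  "top_Cauchy \<T> x \<longleftrightarrow>
     (\<forall>U. openin \<T> U \<and> 0 \<in> U \<longrightarrow> (\<exists>N. \<forall>m\<ge>N. \<forall>n\<ge>N. x m - x n \<in> U))"

definition seq_complete :: "'y::real_vector topology \<Rightarrow> bool" where
  "seq_complete \<T> \<longleftrightarrow>
     (\<forall>x. top_Cauchy \<T> x \<longrightarrow> (\<exists>y. limitin \<T> x y sequentially))"

definition twin_operator ::
  "('d::banach \<Rightarrow> 'y::banach \<Rightarrow> real) \<Rightarrow> ('d \<Rightarrow> 'y \<Rightarrow> real) \<Rightarrow> bool" where
  "twin_operator B L \<longleftrightarrow>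
     bounded_bilinear L \<and>
     (\<forall>y. \<exists>z. \<forall>d. B d z = L d y) \<and>
     (\<forall>d. \<exists>e. \<forall>y. B e y = L d y)"

text \<open>The operators \<open>y \<mapsto> Ly\<close> and \<open>y\<^sup>\<diamond> \<mapsto> y\<^sup>\<diamond>L\<close> of a twin operator; for a norming dual pair the
  represented elements are unique.\<close>

definition twin_app :: "('d \<Rightarrow> 'y \<Rightarrow> real) \<Rightarrow> ('d \<Rightarrow> 'y \<Rightarrow> real) \<Rightarrow> 'y \<Rightarrow> 'y" where
  "twin_app B L y = (THE z. \<forall>d. B d z = L d y)"

definition twin_dual_app :: "('d \<Rightarrow> 'y \<Rightarrow> real) \<Rightarrow> ('d \<Rightarrow> 'y \<Rightarrow> real) \<Rightarrow> 'd \<Rightarrow> 'd" where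
  "twin_dual_app B L d = (THE e. \<forall>y. B e y = L d y)"

definition twin_comp ::
  "('d \<Rightarrow> 'y \<Rightarrow> real) \<Rightarrow> ('d \<Rightarrow> 'y \<Rightarrow> real) \<Rightarrow> ('d \<Rightarrow> 'y \<Rightarrow> real) \<Rightarrow> 'd \<Rightarrow> 'y \<Rightarrow> real" where
  "twin_comp B L1 L2 d y = B (twin_dual_app B L1 d) (twin_app B L2 y)"

text \<open>The complexification of a real space is its square, \<open>(x, x')\<close> standing for \<open>x + i x'\<close>.\<close>

definition cscale :: "complex \<Rightarrow> 'a::real_vector \<times> 'a \<Rightarrow> 'a \<times> 'a" where
  "cscale c p = (Re c *\<^sub>R fst p - Im c *\<^sub>R snd p, Re c *\<^sub>R snd p + Im c *\<^sub>R fst p)"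

text \<open>The complex bilinear extension of a real bilinear form:\<close>

definition complexify :: "('d \<Rightarrow> 'y \<Rightarrow> real) \<Rightarrow> 'd \<times> 'd \<Rightarrow> 'y \<times> 'y \<Rightarrow> complex" where
  "complexify b d y =
     Complex (b (fst d) (fst y) - b (snd d) (snd y)) (b (fst d) (snd y) + b (snd d) (fst y))"

text \<open>Boundedness below refers to the product norm, which need not be homogeneous for complex
  scalars but is equivalent to every standard complexification norm.\<close>

definition complex_twin_operator ::
  "('d::banach \<Rightarrow> 'y::banach \<Rightarrow> real) \<Rightarrow> ('d \<times> 'd \<Rightarrow> 'y \<times> 'y \<Rightarrow> complex) \<Rightarrow> bool" where
  "complex_twin_operator B L \<longleftrightarrow>
     bounded_bilinear L \<and>
     (\<forall>c d y. L (cscale c d) y = c * L d y \<and> L d (cscale c y) = c * L d y) \<and>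
     (\<forall>y. \<exists>z. \<forall>d. complexify B d z = L d y) \<and>
     (\<forall>d. \<exists>e. \<forall>y. complexify B e y = L d y)"

text \<open>Only the values \<open>S t\<close> with \<open>t \<ge> 0\<close> matter, and the identity twin operator is \<open>B\<close> itself.
  The growth rate \<open>\<omega>\<close> is shared by the exponential bound and the Laplace transform conditions.\<close>

definition twin_semigroup ::
  "('d::banach \<Rightarrow> 'y::banach \<Rightarrow> real) \<Rightarrow> (real \<Rightarrow> 'd \<Rightarrow> 'y \<Rightarrow> real) \<Rightarrow> bool" where
  "twin_semigroup B S \<longleftrightarrow>
     (\<forall>t\<ge>0. twin_operator B (S t)) \<and>
     (\<forall>d y. S 0 d y = B d y) \<and>
     (\<forall>t\<ge>0. \<forall>s\<ge>0. \<forall>d y. S (t + s) d y = twin_comp B (S t) (S s) d y) \<and>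
     (\<forall>d y. (\<lambda>t. S t d y) \<in> borel_measurable (lebesgue_on {0..})) \<and>
     (\<exists>M \<omega>. M \<ge> 1 \<and>
        (\<forall>t\<ge>0. \<forall>d y. \<bar>S t d y\<bar> \<le> M * exp (\<omega> * t) * norm y * norm d) \<and>
        (\<forall>l::real. l > \<omega> \<longrightarrow>
           (\<exists>R. twin_operator B R \<and>
              (\<forall>d y. R d y = (LINT t:{0..}|lebesgue. exp (- l * t) * S t d y)))) \<and>
        (\<forall>l::complex. Re l > \<omega> \<and> Im l \<noteq> 0 \<longrightarrow>
           (\<exists>R. complex_twin_operator B R \<and>
              (\<forall>d y. R d y =
                 (LINT t:{0..}|lebesgue. exp (- l * complex_of_real t) * complexify (S t) d y)))))"

end

theory Submission
  imports Defs
begin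

text \<open>For a real \<open>\<lambda> > \<omega>\<close> the Laplace transform gives an element of \<open>Y\<close> representing
  \<open>d \<mapsto> \<integral> exp (- \<lambda> s) S(s) d q ds\<close>. More generally, send a weight \<open>g\<close> on the half line to the
  functional \<open>d \<mapsto> \<integral> g(s) S(s) d q ds\<close>. By the exponential bound on \<open>S\<close>, this map is bounded from
  \<open>L\<^sup>1(exp (\<omega> s) ds)\<close> to the dual of \<open>Y\<^sup>\<diamond>\<close>. The norming property makes \<open>Y\<close> an isometric, hence
  norm closed, subspace of that dual (\<open>represented_of_approximation\<close>). So the weights whose
  functional is represented by an element of \<open>Y\<close> form a closed subspace of the weighted \<open>L\<^sup>1\<close>
  space, and this subspace contains all \<open>exp (- \<lambda> s)\<close> with \<open>\<lambda> > \<omega>\<close>.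

  The span of these exponentials is dense: after the substitution \<open>x = exp (- s)\<close> it consists of
  polynomials in \<open>x\<close> (times a fixed power), and continuous functions on \<open>[0, 1]\<close> are uniform
  limits of polynomials (\<open>bounded_measurable_exp_polynomial_approx\<close>). Hence every bounded measurable weight
  with bounded support is represented (\<open>weighted_integral_represented\<close>), and the convolution at
  time \<open>t\<close> is the functional of the weight \<open>s \<mapsto> f(t - s)\<close> on \<open>[0, t]\<close>.\<close>

section \<open>Norm limits of represented functionals\<close>

lemma norm_le_of_pairing_le:
  assumes "norming_dual_pair B" "\<And>d. \<bar>B d y\<bar> \<le> c * norm d" "c \<ge> 0"
  shows "norm y \<le> c"
proof -
  have "norm y = (SUP d\<in>{d. norm d \<le> 1}. \<bar>B d y\<bar>)"
    using assms(1) unfolding norming_dual_pair_def by blast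
  also have "\<dots> \<le> c"
  proof (rule cSUP_least)
    show "{d::'a. norm d \<le> 1} \<noteq> {}"
      by (simp, rule exI[of _ 0], simp)
    show "\<bar>B d y\<bar> \<le> c" if "d \<in> {d. norm d \<le> 1}" for d
    proof -
      have "c * norm d \<le> c"
        using assms(3) that by (simp add: mult_left_le)
      then show ?thesis
        using assms(2)[of d] by linarith
    qed
  qed
  finally show ?thesis .
qed

text \<open>Functionals that are close in norm have representing elements that are equally close, so the
  elements \<open>z n\<close> form a Cauchy sequence, and completeness of \<open>Y\<close> supplies the limit.\<close>

lemma represented_of_approximation:
  fixes B :: "'d::banach \<Rightarrow> 'y::banach \<Rightarrow> real"
  assumes B: "norming_dual_pair B"
    and approx: "\<And>n d. \<bar>B d (z n) - \<phi> d\<bar> \<le> \<epsilon> n * norm d"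
    and lim: "\<epsilon> \<longlonglongrightarrow> 0" and nonneg: "\<And>n. \<epsilon> n \<ge> 0"
  shows "\<exists>u. \<forall>d. B d u = \<phi> d"
proof -
  interpret bounded_bilinear B
    using B unfolding norming_dual_pair_def by blast
  have dist_z: "norm (z m - z n) \<le> \<epsilon> m + \<epsilon> n" for m n
  proof (rule norm_le_of_pairing_le[OF B])
    show "\<bar>B d (z m - z n)\<bar> \<le> (\<epsilon> m + \<epsilon> n) * norm d" for d
      using approx[of d m] approx[of d n] by (simp add: diff_right distrib_right)
  qed (simp add: nonneg)
  have "Cauchy z"
  proof (rule CauchyI)
    fix e :: real assume "e > 0"
    then obtain N where N: "\<And>n. n \<ge> N \<Longrightarrow> \<epsilon> n < e/2"
      using order_tendstoD(2)[OF lim, of "e/2"] by (auto simp: eventually_sequentially)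
    show "\<exists>N. \<forall>m\<ge>N. \<forall>n\<ge>N. norm (z m - z n) < e"
    proof (intro exI allI impI)
      fix m n assume "m \<ge> N" "n \<ge> N"
      then show "norm (z m - z n) < e"
        using dist_z[of m n] N[of m] N[of n] by linarith
    qed
  qed
  then obtain u where u: "z \<longlonglongrightarrow> u"
    using Cauchy_convergent convergent_def by blast
  have "B d u = \<phi> d" for d
  proof (rule LIMSEQ_unique)
    show "(\<lambda>n. B d (z n)) \<longlonglongrightarrow> B d u"
      by (intro tendsto u tendsto_const)
    have "(\<lambda>n. B d (z n) - \<phi> d) \<longlonglongrightarrow> 0"
    proof (rule Lim_null_comparison)
      show "(\<lambda>n. \<epsilon> n * norm d) \<longlonglongrightarrow> 0"
        using tendsto_mult_left_zero[OF lim] .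
    qed (simp add: approx)
    then show "(\<lambda>n. B d (z n)) \<longlonglongrightarrow> \<phi> d"
      by (simp add: LIM_zero_iff)
  qed
  then show ?thesis by blast
qed

section \<open>Approximation by exponential polynomials\<close>

text \<open>A measurable function is almost everywhere a limit of continuous ones, which may be clipped
  to \<open>[- C, C]\<close>. On a bounded interval such a function is a continuous function of
  \<open>exp (- x)\<close>, to which the Weierstrass theorem on \<open>[0, 1]\<close> applies. The uniform bound
  serves as the domination in an integral limit.\<close>

lemma bounded_measurable_exp_polynomial_approx:
  fixes h :: "real \<Rightarrow> real"
  assumes h: "h \<in> borel_measurable lebesgue" and bound: "\<And>x. \<bar>h x\<bar> \<le> C"
  obtains a :: "nat \<Rightarrow> nat \<Rightarrow> real" and m :: "nat \<Rightarrow> nat" and N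
  where "negligible N"
    and "\<And>n x. x \<ge> 0 \<Longrightarrow> \<bar>\<Sum>i\<le>m n. a n i * exp (- x) ^ i\<bar> \<le> C + 1"
    and "\<And>x. x \<ge> 0 \<Longrightarrow> x \<notin> N \<Longrightarrow> (\<lambda>n. \<Sum>i\<le>m n. a n i * exp (- x) ^ i) \<longlonglongrightarrow> h x"
proof -
  have "h measurable_on UNIV"
    by (rule lebesgue_measurable_imp_measurable_on_real[OF h]) simp
  then obtain N g where N: "negligible N" and g: "\<And>n. continuous_on UNIV (g n)"
    and lim: "\<And>x. x \<notin> N \<Longrightarrow> (\<lambda>n. g n x) \<longlonglongrightarrow> h x"
    unfolding measurable_on_def by auto
  have C: "C \<ge> 0"
    using bound[of 0] by linarith
  define G where "G = (\<lambda>n x. max (- C) (min C (g n x)))"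
  have G_cont: "continuous_on A (G n)" for n A
    unfolding G_def by (intro continuous_intros continuous_on_subset[OF g]) auto
  have G_bound: "\<bar>G n x\<bar> \<le> C" for n x
    using C by (auto simp: G_def)
  have G_lim: "(\<lambda>n. G n x) \<longlonglongrightarrow> h x" if "x \<notin> N" for x
  proof -
    have "(\<lambda>n. G n x) \<longlonglongrightarrow> max (- C) (min C (h x))"
      unfolding G_def by (intro tendsto_intros lim that)
    moreover have "max (- C) (min C (h x)) = h x"
      using bound[of x] by auto
    ultimately show ?thesis by simp
  qed
  \<comment> \<open>Truncating the argument at \<open>exp (- n)\<close> avoids the singularity of \<open>ln\<close> at 0; at a fixed
    point \<open>exp (- x)\<close> the truncation is invisible as soon as \<open>n \<ge> x\<close>.\<close>
  define F where "F = (\<lambda>n y. G n (- ln (max y (exp (- real n)))))"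
  have F_eq: "F n (exp (- x)) = G n x" if "x \<le> real n" for n x
    using that by (simp add: F_def max_def)
  have F_cont: "continuous_on A (F n)" for n A
  proof -
    have "max y (exp (- real n)) \<noteq> 0" for y
      using exp_gt_zero[of "- real n"] by linarith
    then have "continuous_on A (\<lambda>y. - ln (max y (exp (- real n))))"
      by (intro continuous_intros) auto
    then show ?thesis
      unfolding F_def by (rule continuous_on_compose2[OF G_cont[of UNIV]]) simp
  qed
  have "\<exists>a m. \<forall>y\<in>{0..1}. \<bar>F n y - (\<Sum>i\<le>m. a i * y ^ i)\<bar> < inverse (real (Suc n))"
    for n
  proof -
    obtain p where p: "real_polynomial_function p"
      and close: "\<And>y. y \<in> {0..1} \<Longrightarrow> \<bar>F n y - p y\<bar> < inverse (real (Suc n))"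
      by (rule Stone_Weierstrass_real_polynomial_function
          [of "{0..1}" "F n" "inverse (real (Suc n))"])
        (auto intro: F_cont)
    obtain a m where "p = (\<lambda>y. \<Sum>i\<le>m. a i * y ^ i)"
      using p by (auto simp: real_polynomial_function_iff_sum)
    with close show ?thesis by blast
  qed
  then obtain a m where close:
    "\<And>n y. y \<in> {0..1} \<Longrightarrow> \<bar>F n y - (\<Sum>i\<le>m n. a n i * y ^ i)\<bar> < inverse (real (Suc n))"
    by metis
  have close_exp: "\<bar>F n (exp (- x)) - (\<Sum>i\<le>m n. a n i * exp (- x) ^ i)\<bar> < inverse (real (Suc n))"
    if "x \<ge> 0" for n x
    using that by (intro close) auto
  show thesis
  proof (rule that[OF N])
    show "\<bar>\<Sum>i\<le>m n. a n i * exp (- x) ^ i\<bar> \<le> C + 1" if "x \<ge> 0" for n x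
    proof -
      have "inverse (real (Suc n)) \<le> 1"
        by (simp add: field_simps)
      moreover have "\<bar>F n (exp (- x))\<bar> \<le> C"
        unfolding F_def by (rule G_bound)
      ultimately show ?thesis
        using close_exp[OF that, of n] by linarith
    qed
    show "(\<lambda>n. \<Sum>i\<le>m n. a n i * exp (- x) ^ i) \<longlonglongrightarrow> h x" if "x \<ge> 0" "x \<notin> N" for x
    proof -
      have "\<forall>\<^sub>F n in sequentially. F n (exp (- x)) = G n x"
        using eventually_ge_at_top[of "nat \<lceil>x\<rceil>"]
        by eventually_elim (rule F_eq, linarith)
      then have F_lim: "(\<lambda>n. F n (exp (- x))) \<longlonglongrightarrow> h x"
        using G_lim[OF that(2)] by (simp add: tendsto_cong)
      have "(\<lambda>n. F n (exp (- x)) - (\<Sum>i\<le>m n. a n i * exp (- x) ^ i)) \<longlonglongrightarrow> 0"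
        by (rule Lim_null_comparison[OF _ LIMSEQ_inverse_real_of_nat])
          (use close_exp[OF that(1)] in \<open>simp add: less_imp_le always_eventually\<close>)
      from tendsto_diff[OF F_lim this] show ?thesis by simp
    qed
  qed
qed

section \<open>Integrals against an exponentially bounded kernel\<close>

lemma integrable_exp_decay:
  fixes a :: real
  assumes "a > 0"
  shows "integrable (lebesgue_on {0..}) (\<lambda>t. exp (- a * t))"
proof -
  have "(\<lambda>t. exp (- a * t)) absolutely_integrable_on {0..}"
    by (rule nonnegative_absolutely_integrable_1[OF integrable_on_exp_minus_to_infinity[OF assms]]) simp
  then show ?thesis
    by (simp add: integrable_restrict_space set_integrable_def)
qed

text \<open>The kernel \<open>K s d\<close> stands for \<open>S(s) d q\<close> with \<open>q\<close> fixed. A power of \<open>exp (- t)\<close> times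
  \<open>exp (- l t)\<close> is again an exponential with rate above \<open>\<omega>\<close>, so an exponential polynomial in
  place of \<open>h\<close> is covered by the Laplace transforms. The error made by replacing \<open>h\<close> is
  controlled by an integral that does not involve \<open>d\<close>, with the integrable weight
  \<open>w t = exp (- (l - \<omega>) t)\<close>, and it tends to 0 by dominated convergence.\<close>

lemma weighted_integral_represented:
  fixes B :: "'d::banach \<Rightarrow> 'y::banach \<Rightarrow> real" and K :: "real \<Rightarrow> 'd \<Rightarrow> real"
  assumes B: "norming_dual_pair B"
    and K_meas: "\<And>d. (\<lambda>t. K t d) \<in> borel_measurable (lebesgue_on {0..})"
    and K_bound: "\<And>t d. t \<ge> 0 \<Longrightarrow> \<bar>K t d\<bar> \<le> c * exp (\<omega> * t) * norm d"
    and c: "c \<ge> 0"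
    and laplace: "\<And>l. l > \<omega> \<Longrightarrow>
      \<exists>z. \<forall>d. B d z = (LINT t|lebesgue_on {0..}. exp (- l * t) * K t d)"
    and h: "h \<in> borel_measurable lebesgue" and h_bound: "\<And>t. \<bar>h t\<bar> \<le> C"
    and l: "l > \<omega>"
  shows "\<exists>u. \<forall>d. B d u = (LINT t|lebesgue_on {0..}. h t * (exp (- l * t) * K t d))"
proof -
  let ?M = "lebesgue_on {0::real..}"
  interpret bounded_bilinear B
    using B unfolding norming_dual_pair_def by blast
  obtain N a m where N: "negligible N"
    and P_bound: "\<And>n x. x \<ge> 0 \<Longrightarrow> \<bar>\<Sum>i\<le>m n. a n i * exp (- x) ^ i\<bar> \<le> C + 1"
    and P_lim: "\<And>x. x \<ge> 0 \<Longrightarrow> x \<notin> N \<Longrightarrow> (\<lambda>n. \<Sum>i\<le>m n. a n i * exp (- x) ^ i) \<longlonglongrightarrow> h x"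
    by (rule bounded_measurable_exp_polynomial_approx[OF h h_bound]) (rule that)
  define P where "P = (\<lambda>n x. \<Sum>i\<le>m n. a n i * exp (- x) ^ i)"
  define w where "w = (\<lambda>t. exp (- (l - \<omega>) * t))"
  have w_int: "integrable ?M w"
    unfolding w_def using l by (intro integrable_exp_decay) simp
  have wK: "\<bar>exp (- l * t) * K t d\<bar> \<le> (c * norm d) * w t" if "t \<ge> 0" for t d
  proof -
    have "\<bar>exp (- l * t) * K t d\<bar> \<le> exp (- l * t) * (c * exp (\<omega> * t) * norm d)"
      unfolding abs_mult abs_exp_cancel
      by (intro mult_left_mono K_bound that) simp
    also have "\<dots> = (c * norm d) * (exp (- l * t) * exp (\<omega> * t))"
      by simp
    also have "exp (- l * t) * exp (\<omega> * t) = w t"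
      unfolding w_def exp_add[symmetric] by (simp add: algebra_simps)
    finally show ?thesis .
  qed
  have [measurable]: "h \<in> borel_measurable ?M"
    by (rule measurable_restrict_space1[OF h])
  have [measurable]: "(\<lambda>t. K t d) \<in> borel_measurable ?M" for d
    by (rule K_meas)
  have cont_meas: "r \<in> borel_measurable ?M" if "continuous_on {0..} r" for r :: "real \<Rightarrow> real"
    using that by (rule continuous_imp_measurable_on_sets_lebesgue) simp
  have [measurable]: "(\<lambda>t. exp (- l * t)) \<in> borel_measurable ?M"
    by (intro cont_meas continuous_intros)
  have [measurable]: "w \<in> borel_measurable ?M"
    unfolding w_def by (intro cont_meas continuous_intros)
  have [measurable]: "P n \<in> borel_measurable ?M" for n
    unfolding P_def by (intro cont_meas continuous_intros)
  have int_bounded: "integrable ?M (\<lambda>t. r t * (exp (- l * t) * K t d))"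
    if [measurable]: "r \<in> borel_measurable ?M" and r: "\<And>t. t \<ge> 0 \<Longrightarrow> \<bar>r t\<bar> \<le> D" for r D d
  proof (rule Bochner_Integration.integrable_bound)
    show "integrable ?M (\<lambda>t. D * ((c * norm d) * w t))"
      using w_int by simp
    show "AE t in ?M. norm (r t * (exp (- l * t) * K t d)) \<le> norm (D * ((c * norm d) * w t))"
    proof (rule AE_I2)
      fix t assume "t \<in> space ?M"
      then have t: "t \<ge> 0" by simp
      have "norm (r t * (exp (- l * t) * K t d)) = \<bar>r t\<bar> * \<bar>exp (- l * t) * K t d\<bar>"
        by (simp add: abs_mult)
      also have "\<dots> \<le> D * ((c * norm d) * w t)"
        by (rule mult_mono'[OF r[OF t] wK[OF t]]) auto
      also have "\<dots> \<le> norm (D * ((c * norm d) * w t))" by simp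
      finally show "norm (r t * (exp (- l * t) * K t d)) \<le> norm (D * ((c * norm d) * w t))" .
    qed
  qed measurable
  have "\<exists>z. \<forall>d. B d z = (LINT t|?M. P n t * (exp (- l * t) * K t d))" for n
  proof -
    have "\<forall>i. \<exists>z. \<forall>d. B d z = (LINT t|?M. exp (- (l + real i) * t) * K t d)"
      using l by (intro allI laplace) simp
    then obtain z where z: "\<And>i d. B d (z i) = (LINT t|?M. exp (- (l + real i) * t) * K t d)"
      by metis
    have z': "B d (z i) = (LINT t|?M. exp (- t) ^ i * (exp (- l * t) * K t d))" for i d
    proof -
      have "exp (- (l + real i) * t) = exp (real i * - t + - l * t)" for t
        by (simp add: algebra_simps)
      then have "exp (- (l + real i) * t) = exp (- t) ^ i * exp (- l * t)" for t
        by (simp only: exp_add exp_of_nat_mult)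
      then show ?thesis
        by (simp only: z mult.assoc)
    qed
    have summand: "integrable ?M (\<lambda>t. exp (- t) ^ i * (exp (- l * t) * K t d))" for i d
    proof (rule int_bounded[where D = 1])
      show "(\<lambda>t. exp (- t) ^ i) \<in> borel_measurable ?M"
        by (intro cont_meas continuous_intros)
    qed (simp add: power_le_one)
    have "B d (\<Sum>i\<le>m n. a n i *\<^sub>R z i) = (LINT t|?M. P n t * (exp (- l * t) * K t d))" for d
    proof -
      have "B d (\<Sum>i\<le>m n. a n i *\<^sub>R z i) =
          (\<Sum>i\<le>m n. LINT t|?M. a n i * (exp (- t) ^ i * (exp (- l * t) * K t d)))"
        by (simp add: sum_right scaleR_right z')
      also have "\<dots> = (LINT t|?M. (\<Sum>i\<le>m n. a n i * (exp (- t) ^ i * (exp (- l * t) * K t d))))"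
        by (rule Bochner_Integration.integral_sum[symmetric]) (intro integrable_mult_right summand)
      finally show ?thesis
        by (simp add: P_def sum_distrib_right mult.assoc)
    qed
    then show ?thesis by blast
  qed
  then obtain z where z: "\<And>n d. B d (z n) = (LINT t|?M. P n t * (exp (- l * t) * K t d))"
    by metis
  have diff_bound: "\<bar>P n t - h t\<bar> \<le> 2 * C + 1" if "t \<ge> 0" for n t
    using P_bound[OF that, of n] h_bound[of t] unfolding P_def by linarith
  have diff_w: "norm (\<bar>P n t - h t\<bar> * w t) \<le> (2 * C + 1) * w t" if "t \<ge> 0" for n t
    using diff_bound[OF that, of n] by (simp add: w_def abs_mult)
  have AE_lim: "AE t in ?M. (\<lambda>n. \<bar>P n t - h t\<bar> * w t) \<longlonglongrightarrow> 0"
  proof -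
    have "AE t in lebesgue. t \<notin> N"
      using N by (simp add: negligible_iff_null_sets AE_not_in)
    then have "AE t in ?M. t \<notin> N"
      by (subst AE_restrict_space_iff) auto
    then show ?thesis
    proof (rule AE_mp, intro AE_I2 impI)
      fix t assume t: "t \<in> space ?M" "t \<notin> N"
      then have "(\<lambda>n. P n t) \<longlonglongrightarrow> h t"
        unfolding P_def by (intro P_lim) auto
      then have "(\<lambda>n. \<bar>P n t - h t\<bar>) \<longlonglongrightarrow> 0"
        by (intro tendsto_rabs_zero LIM_zero)
      then show "(\<lambda>n. \<bar>P n t - h t\<bar> * w t) \<longlonglongrightarrow> 0"
        by (rule tendsto_mult_left_zero)
    qed
  qed
  have AE_dom: "AE t in ?M. norm (\<bar>P n t - h t\<bar> * w t) \<le> (2 * C + 1) * w t" for n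
    by (rule AE_I2, rule diff_w) simp
  have dom_int: "integrable ?M (\<lambda>t. (2 * C + 1) * w t)"
    using w_int by simp
  have diff_meas: "(\<lambda>t. \<bar>P n t - h t\<bar> * w t) \<in> borel_measurable ?M" for n
    by measurable
  have diff_lim: "(\<lambda>n. LINT t|?M. \<bar>P n t - h t\<bar> * w t) \<longlonglongrightarrow> 0"
    using integral_dominated_convergence[OF _ diff_meas dom_int AE_lim AE_dom] by simp
  have diff_int: "integrable ?M (\<lambda>t. \<bar>P n t - h t\<bar> * w t)" for n
    by (rule integrable_dominated_convergence2[OF _ diff_meas dom_int AE_lim AE_dom]) simp
  have P_int: "integrable ?M (\<lambda>t. P n t * (exp (- l * t) * K t d))" for n d
  proof (rule int_bounded[where D = "C + 1"])
    show "\<bar>P n t\<bar> \<le> C + 1" if "t \<ge> 0" for t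
      unfolding P_def by (rule P_bound[OF that])
  qed measurable
  have h_int: "integrable ?M (\<lambda>t. h t * (exp (- l * t) * K t d))" for d
    by (rule int_bounded[where D = C]) (use h_bound in auto)
  show ?thesis
  proof (rule represented_of_approximation[OF B])
    show "(\<lambda>n. c * (LINT t|?M. \<bar>P n t - h t\<bar> * w t)) \<longlonglongrightarrow> 0"
      using tendsto_mult_right_zero[OF diff_lim] .
    show "0 \<le> c * (LINT t|?M. \<bar>P n t - h t\<bar> * w t)" for n
      using c by (intro mult_nonneg_nonneg integral_nonneg_AE) (auto simp: w_def)
    show "\<bar>B d (z n) - (LINT t|?M. h t * (exp (- l * t) * K t d))\<bar>
        \<le> c * (LINT t|?M. \<bar>P n t - h t\<bar> * w t) * norm d" for n d
    proof -
      have "B d (z n) - (LINT t|?M. h t * (exp (- l * t) * K t d)) =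
          (LINT t|?M. (P n t - h t) * (exp (- l * t) * K t d))"
        unfolding z using P_int h_int by (simp add: left_diff_distrib)
      also have "\<bar>\<dots>\<bar> \<le> (LINT t|?M. (c * norm d) * (\<bar>P n t - h t\<bar> * w t))"
      proof (rule integral_abs_bound_integral)
        show "integrable ?M (\<lambda>t. (P n t - h t) * (exp (- l * t) * K t d))"
          using Bochner_Integration.integrable_diff[OF P_int h_int] by (simp add: left_diff_distrib)
        show "integrable ?M (\<lambda>t. (c * norm d) * (\<bar>P n t - h t\<bar> * w t))"
          using diff_int by simp
        show "\<bar>(P n t - h t) * (exp (- l * t) * K t d)\<bar> \<le> (c * norm d) * (\<bar>P n t - h t\<bar> * w t)"
          if "t \<in> space ?M" for t
          using mult_left_mono[OF wK[of t d], of "\<bar>P n t - h t\<bar>"] that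
          by (simp add: abs_mult ac_simps)
      qed
      also have "\<dots> = c * (LINT t|?M. \<bar>P n t - h t\<bar> * w t) * norm d"
        unfolding integral_mult_right_zero by simp
      finally show ?thesis .
    qed
  qed
qed

section \<open>The convolution with a twin semigroup\<close>

theorem lemma5p1:
  fixes B :: "'d::banach \<Rightarrow> 'y::banach \<Rightarrow> real"
    and S :: "real \<Rightarrow> 'd \<Rightarrow> 'y \<Rightarrow> real"
    and q :: 'y
    and f :: "real \<Rightarrow> real"
    and T t :: real
  assumes "norming_dual_pair B"
    and "seq_complete (weak_top B)"
    and "twin_semigroup B S"
    and "f \<in> borel_measurable (lebesgue_on {0..T})"
    and "bounded (f ` {0..T})"
    and "t \<in> {0..T}"
  shows "\<exists>u. \<forall>d. B d u = (LINT \<tau>:{0..t}|lebesgue. S (t - \<tau>) d q * f \<tau>)"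
proof -
  have "\<exists>M \<omega>. M \<ge> 1 \<and>
      (\<forall>s\<ge>0. \<forall>d y. \<bar>S s d y\<bar> \<le> M * exp (\<omega> * s) * norm y * norm d) \<and>
      (\<forall>l::real. l > \<omega> \<longrightarrow> (\<exists>R. twin_operator B R \<and>
        (\<forall>d y. R d y = (LINT s:{0..}|lebesgue. exp (- l * s) * S s d y))))"
    using assms(3) unfolding twin_semigroup_def by blast
  then obtain M \<omega> where M: "M \<ge> 1"
    and S_bound: "\<And>s d y. s \<ge> 0 \<Longrightarrow> \<bar>S s d y\<bar> \<le> M * exp (\<omega> * s) * norm y * norm d"
    and resolvent: "\<And>l::real. l > \<omega> \<Longrightarrow> \<exists>R. twin_operator B R \<and>
      (\<forall>d y. R d y = (LINT s:{0..}|lebesgue. exp (- l * s) * S s d y))"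
    by (elim exE conjE) (rule that; blast)
  have S_meas: "(\<lambda>s. S s d q) \<in> borel_measurable (lebesgue_on {0..})" for d
    using assms(3) unfolding twin_semigroup_def by blast
  have laplace: "\<exists>z. \<forall>d. B d z = (LINT s|lebesgue_on {0..}. exp (- l * s) * S s d q)"
    if "l > \<omega>" for l
  proof -
    obtain R where "twin_operator B R"
      and R: "\<And>d y. R d y = (LINT s:{0..}|lebesgue. exp (- l * s) * S s d y)"
      using resolvent[OF \<open>l > \<omega>\<close>] by blast
    then obtain z where "\<forall>d. B d z = R d q"
      unfolding twin_operator_def by blast
    then show ?thesis
      by (auto simp: R integral_restrict_space set_lebesgue_integral_def)
  qed
  obtain C where C: "\<And>s. s \<in> {0..T} \<Longrightarrow> \<bar>f s\<bar> \<le> C"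
    using assms(5) unfolding bounded_iff real_norm_def by blast
  have C_nonneg: "C \<ge> 0"
    using C[OF assms(6)] by linarith
  \<comment> \<open>The factor \<open>exp (l * s)\<close> in \<open>h\<close> cancels the damping \<open>exp (- l * s)\<close> that
    \<open>weighted_integral_represented\<close> carries; it is bounded because \<open>h\<close> lives on \<open>{0..t}\<close>.
    For \<open>l > 0\<close> it is largest at \<open>s = t\<close>.\<close>
  define l where "l = \<bar>\<omega>\<bar> + 1"
  have l: "l > \<omega>" "l > 0" by (auto simp: l_def)
  define h where "h = (\<lambda>s. if s \<in> {0..t} then f (t - s) * exp (l * s) else 0)"
  have h_bound: "\<bar>h s\<bar> \<le> C * exp (l * t)" for s
    using C[of "t - s"] C_nonneg l(2) assms(6)
    by (auto simp: h_def abs_mult intro!: mult_mono)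
  have h_meas: "h \<in> borel_measurable lebesgue"
  proof -
    define F where "F = (\<lambda>s. if s \<in> {0..T} then f s else 0)"
    have "F \<in> borel_measurable lebesgue"
      unfolding F_def by (rule borel_measurable_if_I[OF assms(4)]) simp
    then have [measurable]: "(\<lambda>s. F (t - s)) \<in> borel_measurable lebesgue"
      using borel_measurable_affine[of F "-1" t] by simp
    have [measurable]: "(\<lambda>s. exp (l * s)) \<in> borel_measurable lebesgue"
      by (rule measurable_completion) measurable
    have "h = (\<lambda>s. indicator {0..t} s * (F (t - s) * exp (l * s)))"
      using assms(6) by (auto simp: h_def F_def fun_eq_iff)
    moreover have [measurable]: "{0..t} \<in> sets lebesgue" by simp
    ultimately show ?thesis by simp
  qed
  have "\<exists>u. \<forall>d. B d u =
      (LINT s|lebesgue_on {0..}. h s * (exp (- l * s) * S s d q))"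
  proof (rule weighted_integral_represented[OF assms(1) S_meas _ _ laplace h_meas h_bound l(1)])
    show "\<bar>S s d q\<bar> \<le> (M * norm q) * exp (\<omega> * s) * norm d" if "s \<ge> 0" for s d
      using S_bound[OF that, of d q] by (simp add: algebra_simps)
    show "M * norm q \<ge> 0" using M by simp
  qed
  moreover have "(LINT s|lebesgue_on {0..}. h s * (exp (- l * s) * S s d q)) =
      (LINT \<tau>:{0..t}|lebesgue. S (t - \<tau>) d q * f \<tau>)" for d
  proof -
    have "(LINT s|lebesgue_on {0..}. h s * (exp (- l * s) * S s d q)) =
        (LINT s|lebesgue. indicator {0..t} s * (S s d q * f (t - s)))"
    proof (subst integral_restrict_space)
      show "(LINT s|lebesgue. indicator {0..} s *\<^sub>R (h s * (exp (- l * s) * S s d q))) =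
          (LINT s|lebesgue. indicator {0..t} s * (S s d q * f (t - s)))"
        by (rule Bochner_Integration.integral_cong)
          (auto simp: h_def indicator_def exp_minus)
    qed simp
    also have "\<dots> = (LINT \<tau>|lebesgue. indicator {0..t} (t - \<tau>) * (S (t - \<tau>) d q * f \<tau>))"
      by (subst lebesgue_integral_real_affine[where c = "-1" and t = t]) simp_all
    also have "\<dots> = (LINT \<tau>:{0..t}|lebesgue. S (t - \<tau>) d q * f \<tau>)"
      unfolding set_lebesgue_integral_def
      by (rule Bochner_Integration.integral_cong) (auto simp: indicator_def)
    finally show ?thesis .
  qed
  ultimately show ?thesis by simp
qed

end
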